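(* For all bipartite graphs $G$ with $n$ vertices, the extension complexity of $\mathrm{STAB}(G)$ is $O(n^2 / \log n)$.
   Context: The extension complexity $\mathrm{xc}(P)$ of a polytope $P$ is the minimum number of facets of a polytope that affinely projects to $P$. For a graph $G$, $\mathrm{STAB}(G)$ denotes the stable set polytope of $G$, i.e. the convex hull of the characteristic vectors of the stable sets of $G$. *)

theory Defs
  imports "HOL-Analysis.Analysis" "HOL-Analysis.Finite_Function_Topology"
begin

text \<open>
  Polytopes live in the spaces \<^typ>\<open>'a \<Rightarrow>\<^sub>0 real\<close> of finitely supported functions. In particular
  \<^typ>\<open>nat \<Rightarrow>\<^sub>0 real\<close> is the union of the spaces \<open>\<real>\<^sup>d\<close> over all \<open>d\<close>, and each of its polytopes,
  being the convex hull of finitely many points, lies in one of them. This lets the dimension of an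
  extension be existentially quantified inside a formula, which type-indexed spaces do not allow.
\<close>

text \<open>
  The next two definitions are those of \<^const>\<open>aff_dim\<close> and \<^const>\<open>facet_of\<close> with the sort
  \<^class>\<open>euclidean_space\<close> relaxed to \<^class>\<open>real_vector\<close>.
\<close>

definition affine_dim :: "'a::real_vector set \<Rightarrow> int" where
  "affine_dim S = (SOME d :: int.
     \<exists>B. affine hull B = affine hull S \<and> \<not> affine_dependent B \<and> of_nat (card B) = d + 1)"

definition is_facet_of :: "'a::real_vector set \<Rightarrow> 'a set \<Rightarrow> bool" where
  "is_facet_of F S \<longleftrightarrow> F face_of S \<and> F \<noteq> {} \<and> affine_dim F = affine_dim S - 1"

lemma affine_dim_eq_aff_dim: "affine_dim S = aff_dim S"
  by (simp add: affine_dim_def aff_dim_def)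

lemma is_facet_of_iff_facet_of: "is_facet_of F S \<longleftrightarrow> F facet_of S"
  by (simp add: is_facet_of_def facet_of_def affine_dim_eq_aff_dim)

definition affinely_projects_to :: "'a::real_vector set \<Rightarrow> 'b::real_vector set \<Rightarrow> bool" where
  "affinely_projects_to Q P \<longleftrightarrow> (\<exists>L c. linear L \<and> (\<lambda>x. L x + c) ` Q = P)"

definition extension_complexity :: "'a::real_vector set \<Rightarrow> nat" where
  "extension_complexity P = (LEAST k. \<exists>Q :: (nat \<Rightarrow>\<^sub>0 real) set.
     polytope Q \<and> affinely_projects_to Q P \<and> k = card {F. is_facet_of F Q})"

definition simple_graph :: "'a set \<Rightarrow> 'a set set \<Rightarrow> bool" where
  "simple_graph V E \<longleftrightarrow> finite V \<and> (\<forall>e\<in>E. e \<subseteq> V \<and> card e = 2)"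

definition bipartite_graph :: "'a set \<Rightarrow> 'a set set \<Rightarrow> bool" where
  "bipartite_graph V E \<longleftrightarrow> simple_graph V E \<and>
     (\<exists>A B. A \<union> B = V \<and> A \<inter> B = {} \<and> (\<forall>e\<in>E. \<exists>a\<in>A. \<exists>b\<in>B. e = {a, b}))"

definition stable_set :: "'a set \<Rightarrow> 'a set set \<Rightarrow> 'a set \<Rightarrow> bool" where
  "stable_set V E S \<longleftrightarrow> S \<subseteq> V \<and> (\<forall>u\<in>S. \<forall>v\<in>S. {u, v} \<notin> E)"

text \<open>For finite \<open>S\<close>, the function that is 1 on \<open>S\<close> and 0 elsewhere.\<close>

definition char_vector :: "'a set \<Rightarrow> 'a \<Rightarrow>\<^sub>0 real" where
  "char_vector S = (\<Sum>v\<in>S. Poly_Mapping.single v 1)"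

definition STAB :: "'a set \<Rightarrow> 'a set set \<Rightarrow> ('a \<Rightarrow>\<^sub>0 real) set" where
  "STAB V E = convex hull (char_vector ` {S. stable_set V E S})"

end

theory Submission
  imports Defs
begin

text \<open>
  Let \<open>A\<close> and \<open>B\<close> be the sides of the bipartition and cover the edges by bicliques \<open>(X\<^sub>i, Y\<^sub>i)\<close>.
  Introduce a variable \<open>y\<^sub>i\<close> for each of them and require \<open>x\<^sub>a \<le> y\<^sub>i\<close> for \<open>a \<in> X\<^sub>i\<close> and
  \<open>y\<^sub>i \<le> 1 - x\<^sub>b\<close> for \<open>b \<in> Y\<^sub>i\<close>. In the coordinates \<open>z\<^sub>a = x\<^sub>a\<close>, \<open>z\<^sub>b = 1 - x\<^sub>b\<close> this is an order
  polytope, so its vertices are the indicators of up-sets, and these project exactly onto the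
  indicators of stable sets. A facet of a polyhedron is cut out by one of its defining
  inequalities, so the extension has at most \<open>2 (n + m) + \<Sum>\<^sub>i (|X\<^sub>i| + |Y\<^sub>i|)\<close> facets, where \<open>m\<close>
  is the number of bicliques.

  For a cheap cover split \<open>A\<close> into blocks of size \<open>k\<close>; each subset \<open>S\<close> of a block \<open>T\<close> forms a
  biclique with the vertices whose neighbourhood in \<open>T\<close> is exactly \<open>S\<close>. A block contributes
  \<open>O(k 2\<^sup>k + n)\<close>, and the largest \<open>k\<close> with \<open>k 2\<^sup>k \<le> n\<close> is of order \<open>log n\<close>.
\<close>

section \<open>Facets in real vector spaces\<close>

text \<open>Translating a point of each set to the origin reduces this to the exchange bound for
  linearly independent sets in the span of a finite set. Finiteness of \<open>S\<close> is stated as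
  well because \<open>card\<close> is 0 on infinite sets.\<close>

lemma affine_independent_card_le:
  fixes S T :: "'a::real_vector set"
  assumes "finite T" "\<not> affine_dependent S" "S \<subseteq> affine hull T"
  shows "finite S \<and> card S \<le> card T"
proof (cases "S = {}")
  case False
  then obtain s where s: "s \<in> S" by blast
  have "T \<noteq> {}" using False assms(3) by auto
  then obtain t where t: "t \<in> T" by blast
  let ?S = "(\<lambda>x. -s + x) ` (S - {s})" and ?T = "(\<lambda>x. -t + x) ` (T - {t})"
  have hull: "affine hull T = (\<lambda>x. t + x) ` span ?T"
    using affine_hull_span2[OF t] .
  have "?S \<subseteq> span ?T"
  proof
    fix y assume "y \<in> ?S"
    then obtain x where x: "x \<in> S" "y = -s + x" by blast
    have "x \<in> (\<lambda>x. t + x) ` span ?T" "s \<in> (\<lambda>x. t + x) ` span ?T"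
      using x s assms(3) hull by auto
    then obtain a b where "x = t + a" "s = t + b" "a \<in> span ?T" "b \<in> span ?T"
      by blast
    then show "y \<in> span ?T"
      using span_diff[of a ?T b] by (simp add: x(2))
  qed
  moreover have "independent ?S"
    using affine_dependent_iff_dependent2[OF s] assms(2) by blast
  ultimately have bound: "finite ?S \<and> card ?S \<le> card ?T"
    using independent_span_bound[of ?T ?S] assms(1) by auto
  have "finite (S - {s})"
    using bound by (simp add: finite_image_iff inj_on_def)
  moreover have "card ?S = card (S - {s})" "card ?T = card (T - {t})"
    by (auto intro!: card_image simp: inj_on_def)
  moreover have "card S = Suc (card (S - {s}))" if "finite S"
    using card.remove[OF that s] .
  moreover have "card T = Suc (card (T - {t}))"
    using card.remove[OF assms(1) t] .
  ultimately show ?thesis using bound by auto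
qed auto

text \<open>Turns the choice in \<open>affine_dim\<close> into an actual basis. That basis may be
  infinite, with \<open>card\<close> 0, which is why later arguments confine the sets to the hull of
  a finite \<open>A\<close>.\<close>

lemma affine_dim_basis_exists:
  fixes S :: "'a::real_vector set"
  obtains B where "affine hull B = affine hull S" "\<not> affine_dependent B"
    "int (card B) = affine_dim S + 1"
proof -
  obtain B0 where "\<not> affine_dependent B0" "affine hull B0 = affine hull S"
    using affine_basis_exists[of S] by auto
  then have "\<exists>d B. affine hull B = affine hull S \<and> \<not> affine_dependent B \<and> int (card B) = d + 1"
    by (intro exI[of _ "int (card B0) - 1"] exI[of _ B0]) auto
  from someI_ex[OF this] show thesis
    using that unfolding affine_dim_def by blast
qed

text \<open>An affine basis of the smaller hull extends to one of the larger hull, properly so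
  because the hulls differ; \<open>A\<close> keeps the bases finite.\<close>

lemma affine_dim_less:
  fixes S T :: "'a::real_vector set"
  assumes "affine hull S \<subset> affine hull T" "finite A" "T \<subseteq> affine hull A"
  shows "affine_dim S < affine_dim T"
proof -
  obtain B where B: "affine hull B = affine hull S" "\<not> affine_dependent B"
    "int (card B) = affine_dim S + 1"
    by (rule affine_dim_basis_exists)
  obtain D where D: "affine hull D = affine hull T" "\<not> affine_dependent D"
    "int (card D) = affine_dim T + 1"
    by (rule affine_dim_basis_exists)
  have "B \<subseteq> affine hull T"
    using hull_subset[of B affine] B(1) assms(1) by auto
  then obtain C where C: "\<not> affine_dependent C" "B \<subseteq> C" "C \<subseteq> affine hull T"
    "affine hull C = affine hull (affine hull T)"
    using extend_to_affine_basis[OF B(2)] by metis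
  have "affine hull T \<subseteq> affine hull A"
    using assms(3) by (simp add: hull_minimal)
  then have "D \<subseteq> affine hull A"
    using hull_subset[of D affine] D(1) by auto
  then have "finite D"
    using affine_independent_card_le assms(2) D(2) by blast
  then have "finite C \<and> card C \<le> card D"
    using affine_independent_card_le C(1,3) D(1) by metis
  moreover have "B \<noteq> C"
    using B(1) C(4) assms(1) by auto
  ultimately have "card B < card D"
    using C(2) by (meson order_less_le_trans psubsetI psubset_card_mono)
  then show ?thesis using B(3) D(3) by linarith
qed

text \<open>A nonempty face consists of the points of \<open>Q\<close> that satisfy with equality
  every constraint tight on the whole face. For a facet, a dimension count shows that a single such
  constraint already cuts it out.\<close>

lemma facets_of_halfspace_intersection:
  fixes g :: "'j \<Rightarrow> 'a::real_vector \<Rightarrow> real"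
  assumes "finite J" "affine M" "finite A" "Q \<subseteq> affine hull A"
    and Q: "Q = {z \<in> M. \<forall>j\<in>J. 0 \<le> g j z}"
    and g: "\<And>j x y u v. j \<in> J \<Longrightarrow> u + v = 1 \<Longrightarrow> g j (u *\<^sub>R x + v *\<^sub>R y) = u * g j x + v * g j y"
  shows "{F. is_facet_of F Q} \<subseteq> (\<lambda>j. {z \<in> Q. g j z = 0}) ` J"
proof
  fix F assume "F \<in> {F. is_facet_of F Q}"
  then have face: "F face_of Q" and "F \<noteq> {}" and dim: "affine_dim F = affine_dim Q - 1"
    by (auto simp: is_facet_of_def)
  then have FQ: "F \<subseteq> Q" and "convex F" by (auto simp: face_of_def)
  define K where "K = {j \<in> J. \<exists>x\<in>F. 0 < g j x}"
  have "finite K" "K \<subseteq> J" using assms(1) by (auto simp: K_def)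
  have nonneg: "0 \<le> g j x" if "j \<in> J" "x \<in> Q" for j x
    using that unfolding Q by blast
  have tight: "g j x = 0" if "j \<in> J - K" "x \<in> F" for j x
  proof -
    have "0 \<le> g j x" using that FQ nonneg by blast
    moreover have "\<not> 0 < g j x" using that unfolding K_def by blast
    ultimately show ?thesis by simp
  qed

  \<comment> \<open>A point of \<open>F\<close> that is slack in all of \<open>K\<close> at once,
    playing the role of a relative interior point. Midpoints preserve the slack gained so far, since
    every \<open>g i\<close> is nonnegative on \<open>F\<close>.\<close>
  have "\<exists>p\<in>F. \<forall>j\<in>K. 0 < g j p"
    using \<open>finite K\<close> subset_refl[of K]
  proof (induction K rule: finite_subset_induct')
    case empty
    then show ?case using \<open>F \<noteq> {}\<close> by auto
  next
    case (insert j K')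
    then obtain p x where p: "p \<in> F" "\<forall>i\<in>K'. 0 < g i p" and x: "x \<in> F" "0 < g j x"
      by (auto simp: K_def)
    let ?m = "(1/2) *\<^sub>R p + (1/2) *\<^sub>R x"
    have "?m \<in> F"
      using \<open>convex F\<close> p(1) x(1) by (intro convexD) auto
    moreover have "g i ?m = g i p / 2 + g i x / 2" if "i \<in> J" for i
      using g[OF that, of "1/2" "1/2" p x] by simp
    moreover have "0 \<le> g i p" "0 \<le> g i x" if "i \<in> J" for i
      using that p(1) x(1) FQ nonneg by blast+
    moreover have "i \<in> J" "0 < g i p \<or> 0 < g i x" if "i \<in> insert j K'" for i
      using that insert(2,3) p(2) x(2) \<open>K \<subseteq> J\<close> by auto
    ultimately have "0 < g i ?m" if "i \<in> insert j K'" for i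
      using that by (smt (verit) field_sum_of_halves)
    then show ?case using \<open>?m \<in> F\<close> by blast
  qed
  then obtain p where p: "p \<in> F" "\<And>j. j \<in> K \<Longrightarrow> 0 < g j p" by blast

  \<comment> \<open>The segment from \<open>q\<close> to \<open>p\<close> can be prolonged beyond
    \<open>p\<close> inside \<open>Q\<close>. So \<open>p\<close> is in an open segment starting at
    \<open>q\<close>, and the face property forces \<open>q\<close> into \<open>F\<close>.\<close>
  have F_eq: "q \<in> F" if q: "q \<in> Q" "\<And>j. j \<in> J - K \<Longrightarrow> g j q = 0" for q
  proof (cases "q = p")
    case False
    have "\<exists>e>0. \<forall>j\<in>K. e * g j q \<le> g j p"
      using \<open>finite K\<close> subset_refl[of K]
    proof (induction K rule: finite_subset_induct')
      case empty
      then show ?case by (auto intro: exI[of _ 1])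
    next
      case (insert j K')
      then obtain e where e: "e > 0" "\<forall>i\<in>K'. e * g i q \<le> g i p" by blast
      have gq: "0 \<le> g i q" if "i \<in> K" for i
        using that q(1) \<open>K \<subseteq> J\<close> nonneg by blast
      \<comment> \<open>The summand 1 in the denominator covers the case
        \<open>g j q = 0\<close>.\<close>
      define d where "d = min e (g j p / (1 + g j q))"
      have "0 < d" using e(1) p(2)[OF insert(2)] gq[OF insert(2)] by (simp add: d_def)
      moreover have "d * g i q \<le> g i p" if "i \<in> K'" for i
        using e(2) that insert(3) gq[of i] mult_right_mono[of d e "g i q"]
        by (force simp: d_def)
      moreover have "d * g j q \<le> g j p"
      proof -
        have "d * g j q \<le> d * (1 + g j q)" using \<open>0 < d\<close> by (simp add: algebra_simps)
        also have "\<dots> \<le> g j p / (1 + g j q) * (1 + g j q)"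
          using gq[OF insert(2)] by (intro mult_right_mono) (auto simp: d_def)
        also have "\<dots> = g j p" using gq[OF insert(2)] by simp
        finally show ?thesis .
      qed
      ultimately show ?case by blast
    qed
    then obtain e where e: "e > 0" "\<And>j. j \<in> K \<Longrightarrow> e * g j q \<le> g j p" by blast
    \<comment> \<open>The point beyond \<open>p\<close> on the ray from \<open>q\<close>. The choice
      of \<open>e\<close> keeps the constraints in \<open>K\<close> nonnegative there; all others
      vanish at both \<open>p\<close> and \<open>q\<close>.\<close>
    define r where "r = (1 + e) *\<^sub>R p + (- e) *\<^sub>R q"
    have "p \<in> M" "q \<in> M" using p(1) FQ q(1) by (auto simp: Q)
    then have "r \<in> M"
      unfolding r_def using \<open>affine M\<close> by (intro mem_affine) auto
    moreover have "0 \<le> g j r" if j: "j \<in> J" for j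
    proof -
      have "g j r = (1 + e) * g j p + (- e) * g j q"
        unfolding r_def by (rule g[OF j]) simp
      moreover have "0 \<le> g j p" using p(1) FQ j nonneg by blast
      then have "0 \<le> e * g j p" using e(1) by simp
      moreover have "g j p = 0 \<and> g j q = 0" if "j \<notin> K"
        using that j tight p(1) q(2) by blast
      ultimately show ?thesis
        using e(2)[of j] by (cases "j \<in> K") (auto simp: algebra_simps)
    qed
    ultimately have "r \<in> Q" unfolding Q by blast
    have "p - q = (inverse (1 + e) * (1 + e)) *\<^sub>R (p - q)"
      using e(1) by simp
    also have "\<dots> = inverse (1 + e) *\<^sub>R (r - q)"
      by (simp only: scaleR_scaleR[symmetric]) (simp add: r_def algebra_simps)
    finally have "p = (1 - inverse (1 + e)) *\<^sub>R q + inverse (1 + e) *\<^sub>R r"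
      by (simp add: algebra_simps)
    moreover have "0 < inverse (1 + e)" "inverse (1 + e) < 1"
      using e(1) by (auto simp: field_simps)
    moreover have "q \<noteq> r"
      using calculation(1) False by (auto simp: algebra_simps)
    ultimately have "p \<in> open_segment q r"
      unfolding in_segment by blast
    then show ?thesis
      using face_ofD[OF face] q(1) \<open>r \<in> Q\<close> p(1) by blast
  qed (use p in simp)

  \<comment> \<open>The drop in dimension yields a point of \<open>Q\<close> outside
    \<open>F\<close>; by the previous claim, some constraint tight on \<open>F\<close> is not tight
    there.\<close>
  have "F \<noteq> Q" using dim by auto
  then obtain q where q: "q \<in> Q" "q \<notin> F" using FQ by blast
  then obtain j where j: "j \<in> J" "j \<notin> K" "g j q \<noteq> 0" using F_eq by blast
  define G where "G = {z \<in> Q. g j z = 0}"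
  have "F \<subseteq> G" using FQ tight j by (auto simp: G_def)
  have affine_zero: "affine {z. g i z = 0}" if "i \<in> J" for i
    using g[OF that] by (auto simp: affine_def)
  have "affine hull G \<subseteq> {z. g j z = 0}"
    by (rule hull_minimal) (use affine_zero j in \<open>auto simp: G_def\<close>)
  then have "q \<notin> affine hull G" using j by auto
  moreover have "q \<in> affine hull Q" using q by (simp add: hull_inc)
  moreover have "G \<subseteq> Q" by (auto simp: G_def)
  ultimately have "affine hull G \<subset> affine hull Q"
    by (metis hull_mono psubsetI)
  then have "affine_dim G < affine_dim Q"
    using affine_dim_less assms by blast
  \<comment> \<open>If the hulls differed, \<open>affine_dim G\<close> would be an integer strictly
    between \<open>affine_dim Q - 1\<close> and \<open>affine_dim Q\<close>.\<close>
  moreover have "affine_dim F < affine_dim G" if "affine hull F \<noteq> affine hull G"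
    using affine_dim_less[of F G A] that \<open>F \<subseteq> G\<close> \<open>G \<subseteq> Q\<close> assms(3,4) hull_mono[of F G]
    by blast
  ultimately have hull_eq: "affine hull F = affine hull G"
    using dim by force
  have "G \<subseteq> F"
  proof
    fix x assume x: "x \<in> G"
    have "g i x = 0" if i: "i \<in> J - K" for i
    proof -
      have "affine hull F \<subseteq> {z. g i z = 0}"
        by (rule hull_minimal) (use affine_zero tight i in auto)
      then show ?thesis using x hull_eq hull_inc[of x G affine] by auto
    qed
    then show "x \<in> F" using F_eq x \<open>G \<subseteq> Q\<close> by blast
  qed
  then have "F = G" using \<open>F \<subseteq> G\<close> by blast
  then show "F \<in> (\<lambda>j. {z \<in> Q. g j z = 0}) ` J"
    using j by (auto simp: G_def)
qed

section \<open>Order polytopes\<close>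

lemma lookup_scaleR: "Poly_Mapping.lookup (r *\<^sub>R x) i = r * Poly_Mapping.lookup x i"
  for x :: "'a \<Rightarrow>\<^sub>0 real"
proof -
  have "finite {i. r * Poly_Mapping.lookup x i \<noteq> 0}"
    by (rule finite_subset[OF _ finite_keys[of x]]) (auto simp: in_keys_iff)
  then show ?thesis by (simp add: scaleR_poly_mapping_def)
qed

lemma lookup_char_vector:
  assumes "finite S"
  shows "Poly_Mapping.lookup (char_vector S) v = (if v \<in> S then 1 else 0)"
  using assms by (simp add: char_vector_def lookup_sum lookup_single when_def)

text \<open>Stanley's order polytope, for a relation that need not be a partial order. Fixing the
  coordinates off \<open>N\<close> at 0 keeps it in finite dimension when \<open>N\<close> is
  finite.\<close>

definition order_polytope :: "'b set \<Rightarrow> ('b \<times> 'b) set \<Rightarrow> ('b \<Rightarrow>\<^sub>0 real) set" where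
  "order_polytope N R = {z. (\<forall>s. s \<notin> N \<longrightarrow> Poly_Mapping.lookup z s = 0) \<and>
     (\<forall>s\<in>N. 0 \<le> Poly_Mapping.lookup z s \<and> Poly_Mapping.lookup z s \<le> 1) \<and>
     (\<forall>(s, t)\<in>R. Poly_Mapping.lookup z s \<le> Poly_Mapping.lookup z t)}"

definition up_sets :: "'b set \<Rightarrow> ('b \<times> 'b) set \<Rightarrow> 'b set set" where
  "up_sets N R = {U. U \<subseteq> N \<and> (\<forall>(s, t)\<in>R. s \<in> U \<longrightarrow> t \<in> U)}"

lemma finite_up_sets: "finite N \<Longrightarrow> finite (up_sets N R)"
  by (rule finite_subset[of _ "Pow N"]) (auto simp: up_sets_def)

text \<open>Peel off the smallest positive value of \<open>z\<close>: its support is an up-set.\<close>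

lemma monotone_in_scaled_hull_up_sets:
  fixes z :: "'b \<Rightarrow>\<^sub>0 real"
  assumes "finite N" "0 \<le> r" "\<And>s. s \<notin> N \<Longrightarrow> Poly_Mapping.lookup z s = 0"
    and "\<And>s. 0 \<le> Poly_Mapping.lookup z s" "\<And>s. Poly_Mapping.lookup z s \<le> r"
    and "\<And>s t. (s, t) \<in> R \<Longrightarrow> Poly_Mapping.lookup z s \<le> Poly_Mapping.lookup z t"
  shows "z \<in> (*\<^sub>R) r ` (convex hull (char_vector ` up_sets N R))"
  using assms
\<comment> \<open>The bound \<open>r\<close> varies because peeling off the least value
  \<open>\<mu>\<close> lowers it to \<open>r - \<mu>\<close>. The support shrinks, as it loses the
  keys where the minimum is attained.\<close>
proof (induction "card (Poly_Mapping.keys z)" arbitrary: z r rule: less_induct)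
  case less
  let ?H = "convex hull (char_vector ` up_sets N R)"
  let ?l = Poly_Mapping.lookup
  show ?case
  proof (cases "Poly_Mapping.keys z = {}")
    case True
    then have "z = r *\<^sub>R char_vector {}"
      by (simp add: char_vector_def)
    moreover have "char_vector {} \<in> ?H"
      by (rule hull_inc) (auto simp: up_sets_def)
    ultimately show ?thesis by blast
  next
    case False
    let ?U = "Poly_Mapping.keys z"
    define \<mu> where "\<mu> = Min (?l z ` ?U)"
    define z' where "z' = z - \<mu> *\<^sub>R char_vector ?U"
    have "\<mu> \<in> ?l z ` ?U" unfolding \<mu>_def using False by (intro Min_in) auto
    then obtain k where k: "k \<in> ?U" "\<mu> = ?l z k" by blast
    have le: "\<mu> \<le> ?l z s" if "s \<in> ?U" for s
      unfolding \<mu>_def using that by (intro Min_le) auto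
    have "0 < \<mu>" using k less.prems(4)[of k] by (auto simp: in_keys_iff less_le)
    have "\<mu> \<le> r" using k less.prems(5) by simp
    have l': "?l z' s = (if s \<in> ?U then ?l z s - \<mu> else 0)" for s
      by (simp add: z'_def lookup_minus lookup_scaleR lookup_char_vector in_keys_iff)
    have U: "?U \<in> up_sets N R"
    proof -
      have "t \<in> ?U" if "(s, t) \<in> R" "s \<in> ?U" for s t
        using less.prems(4)[of s] less.prems(6)[OF that(1)] that(2) by (auto simp: in_keys_iff)
      moreover have "?U \<subseteq> N" using less.prems(3) by (auto simp: in_keys_iff)
      ultimately show ?thesis by (auto simp: up_sets_def)
    qed
    have "Poly_Mapping.keys z' \<subset> ?U"
      using k l' by (auto simp: in_keys_iff split: if_splits)
    then have "card (Poly_Mapping.keys z') < card ?U"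
      by (simp add: psubset_card_mono)
    then have "z' \<in> (*\<^sub>R) (r - \<mu>) ` ?H"
    proof (rule less.hyps)
      show "?l z' s \<le> ?l z' t" if st: "(s, t) \<in> R" for s t
      proof (cases "s \<in> ?U")
        case True
        then have "t \<in> ?U" using U st by (auto simp: up_sets_def)
        then show ?thesis using True less.prems(6)[OF st] by (simp add: l')
      next
        case False
        then show ?thesis using le by (auto simp: l')
      qed
    qed (use less.prems le \<open>\<mu> \<le> r\<close> in \<open>auto simp: l'\<close>)
    then obtain h where h: "h \<in> ?H" "z' = (r - \<mu>) *\<^sub>R h" by blast
    \<comment> \<open>Dividing by \<open>r\<close> turns the decomposition of \<open>z\<close> into
      a convex combination; for \<open>\<mu> = r\<close> the point \<open>h\<close> gets weight
      0.\<close>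
    let ?w = "(\<mu> / r) *\<^sub>R char_vector ?U + ((r - \<mu>) / r) *\<^sub>R h"
    have "0 < r" using \<open>0 < \<mu>\<close> \<open>\<mu> \<le> r\<close> by simp
    have "z = r *\<^sub>R ?w"
      using h(2) \<open>0 < r\<close> by (simp add: z'_def scaleR_add_right diff_eq_eq add.commute)
    moreover have "char_vector ?U \<in> ?H" using U by (simp add: hull_inc)
    then have "?w \<in> ?H"
      using h(1) \<open>0 < \<mu>\<close> \<open>\<mu> \<le> r\<close> by (intro convexD) (auto simp: convex_convex_hull field_simps)
    ultimately show ?thesis by blast
  qed
qed

text \<open>The nontrivial inclusion is the peeling lemma with \<open>r = 1\<close>. The description
  by points shows that this is a polytope and makes its projection computable on indicators.\<close>

lemma order_polytope_eq_hull:
  assumes "finite N"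
  shows "order_polytope N R = convex hull (char_vector ` up_sets N R)"
proof
  have "convex (order_polytope N R)"
  proof (rule convexI)
    fix x y :: "'a \<Rightarrow>\<^sub>0 real" and u v :: real
    assume xy: "x \<in> order_polytope N R" "y \<in> order_polytope N R" and uv: "0 \<le> u" "0 \<le> v" "u + v = 1"
    have "u * a + v * b \<le> 1" if "a \<le> 1" "b \<le> 1" for a b :: real
      using convex_bound_le[OF that uv] .
    then show "u *\<^sub>R x + v *\<^sub>R y \<in> order_polytope N R"
      using xy uv unfolding order_polytope_def
      by (fastforce simp: lookup_add lookup_scaleR intro: add_mono mult_left_mono)
  qed
  moreover have "char_vector U \<in> order_polytope N R" if "U \<in> up_sets N R" for U
    using that finite_subset[OF _ assms, of U]
    by (auto simp: up_sets_def order_polytope_def lookup_char_vector)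
  ultimately show "convex hull (char_vector ` up_sets N R) \<subseteq> order_polytope N R"
    by (intro hull_minimal) auto
  show "order_polytope N R \<subseteq> convex hull (char_vector ` up_sets N R)"
  proof
    fix z assume z: "z \<in> order_polytope N R"
    have "0 \<le> Poly_Mapping.lookup z s" "Poly_Mapping.lookup z s \<le> 1" for s
      using z by (cases "s \<in> N"; force simp: order_polytope_def)+
    then show "z \<in> convex hull (char_vector ` up_sets N R)"
      using monotone_in_scaled_hull_up_sets[OF assms, of 1 z R] z
      by (fastforce simp: order_polytope_def)
  qed
qed

text \<open>The equations off \<open>N\<close> are absorbed into the affine set, so only the
  inequalities indexed by \<open>R <+> (N <+> N)\<close> are counted.\<close>

lemma card_facets_order_polytope_le:
  assumes "finite N" "finite R"
  shows "card {F. is_facet_of F (order_polytope N R)} \<le> card R + 2 * card N"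
proof -
  let ?l = Poly_Mapping.lookup
  let ?J = "R <+> (N <+> N)"
  define g where "g = (\<lambda>j (z :: 'a \<Rightarrow>\<^sub>0 real). case j of Inl (s, t) \<Rightarrow> ?l z t - ?l z s
    | Inr (Inl s) \<Rightarrow> ?l z s | Inr (Inr s) \<Rightarrow> 1 - ?l z s)"
  have "{F. is_facet_of F (order_polytope N R)} \<subseteq>
    (\<lambda>j. {z \<in> order_polytope N R. g j z = 0}) ` ?J"
  proof (rule facets_of_halfspace_intersection)
    show "affine {z :: 'a \<Rightarrow>\<^sub>0 real. \<forall>s. s \<notin> N \<longrightarrow> ?l z s = 0}"
      by (auto simp: affine_def lookup_add lookup_scaleR)
    show "finite (char_vector ` up_sets N R)"
      using finite_up_sets[OF assms(1)] by simp
    show "order_polytope N R \<subseteq> affine hull (char_vector ` up_sets N R)"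
      using order_polytope_eq_hull[OF assms(1)] convex_hull_subset_affine_hull by metis
    show "order_polytope N R = {z \<in> {z. \<forall>s. s \<notin> N \<longrightarrow> ?l z s = 0}. \<forall>j\<in>?J. 0 \<le> g j z}"
      by (fastforce simp: order_polytope_def g_def Plus_def ball_Un)
    fix j and x y :: "'a \<Rightarrow>\<^sub>0 real" and u v :: real
    assume uv: "u + v = 1"
    then have "v = 1 - u" by simp
    then show "g j (u *\<^sub>R x + v *\<^sub>R y) = u * g j x + v * g j y"
      by (auto simp: g_def lookup_add lookup_scaleR algebra_simps split: sum.splits prod.splits)
  qed (use assms in auto)
  then have "card {F. is_facet_of F (order_polytope N R)} \<le> card ?J"
    using assms by (intro surj_card_le) auto
  then show ?thesis using assms by (simp add: card_Plus)
qed

section \<open>Stable set polytopes of bipartite graphs\<close>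

text \<open>Both directions of \<open>cover\<close> matter: covering every edge makes up-sets
  project to stable sets, and having only edges in each \<open>X i\<close>, \<open>Y i\<close> lets
  every stable set be lifted.\<close>

lemma extension_complexity_STAB_le_biclique_cover:
  fixes A B :: "'a set" and X Y :: "'i \<Rightarrow> 'a set"
  assumes fin: "finite A" "finite B" "finite I" and disj: "A \<inter> B = {}"
    and E: "\<And>e. e \<in> E \<Longrightarrow> \<exists>a\<in>A. \<exists>b\<in>B. e = {a, b}"
    and XY: "\<And>i. i \<in> I \<Longrightarrow> X i \<subseteq> A" "\<And>i. i \<in> I \<Longrightarrow> Y i \<subseteq> B"
    and cover: "\<And>a b. a \<in> A \<Longrightarrow> b \<in> B \<Longrightarrow> {a, b} \<in> E \<longleftrightarrow> (\<exists>i\<in>I. a \<in> X i \<and> b \<in> Y i)"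
  shows "extension_complexity (STAB (A \<union> B) E) \<le>
    2 * (card (A \<union> B) + card I) + (\<Sum>i\<in>I. card (X i) + card (Y i))"
proof -
  let ?l = Poly_Mapping.lookup
  define n where "n = card (A \<union> B)"
  obtain f where "bij_betw f (A \<union> B) {0..<n}"
    unfolding n_def using fin ex_bij_betw_finite_nat[of "A \<union> B"] by auto
  then have inj: "inj_on f (A \<union> B)" and f: "\<And>v. v \<in> A \<union> B \<Longrightarrow> f v < n"
    by (auto simp: bij_betw_def)
  obtain h where "bij_betw h I {0..<card I}"
    using fin ex_bij_betw_finite_nat[of I] by auto
  then have injh: "inj_on h I" and h: "\<And>i. i \<in> I \<Longrightarrow> h i < card I"
    by (auto simp: bij_betw_def)
  \<comment> \<open>Extensions live over \<open>nat\<close>, so vertices take the coordinates below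
    \<open>n\<close> and biclique \<open>i\<close> takes \<open>n + h i\<close>.\<close>
  define N where "N = {0..<n + card I}"
  define R where "R = (\<Union>i\<in>I. (\<lambda>a. (f a, n + h i)) ` X i \<union> (\<lambda>b. (n + h i, f b)) ` Y i)"
  have finXY: "finite (X i)" "finite (Y i)" if "i \<in> I" for i
    using XY[OF that] fin finite_subset by blast+
  have "finite R" using fin finXY by (auto simp: R_def)
  have "finite N" by (simp add: N_def)
  have card_R: "card R \<le> (\<Sum>i\<in>I. card (X i) + card (Y i))"
  proof -
    have "card R \<le> (\<Sum>i\<in>I. card ((\<lambda>a. (f a, n + h i)) ` X i \<union> (\<lambda>b. (n + h i, f b)) ` Y i))"
      unfolding R_def by (rule card_UN_le[OF fin(3)])
    also have "\<dots> \<le> (\<Sum>i\<in>I. card (X i) + card (Y i))"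
      by (intro sum_mono order_trans[OF card_Un_le] add_mono card_image_le finXY)
    finally show ?thesis .
  qed

  \<comment> \<open>The linear part of \<open>z_a\<close> to \<open>x_a = z_a\<close> and
    \<open>z_b\<close> to \<open>x_b = 1 - z_b\<close>; the constant 1 on \<open>B\<close> becomes
    the translation by \<open>char_vector B\<close>.\<close>
  define L where "L = (\<lambda>z :: nat \<Rightarrow>\<^sub>0 real.
    (\<Sum>v\<in>A. ?l z (f v) *\<^sub>R Poly_Mapping.single v (1::real)) -
    (\<Sum>v\<in>B. ?l z (f v) *\<^sub>R Poly_Mapping.single v 1))"
  have "linear L"
    by (rule linearI)
      (simp_all add: L_def lookup_add lookup_scaleR scaleR_add_left sum.distrib
        scaleR_sum_right scaleR_diff_right)
  have lookup_L: "?l (L z + char_vector B) v =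
      (if v \<in> A then ?l z (f v) else if v \<in> B then 1 - ?l z (f v) else 0)" for z v
  proof -
    have *: "(\<Sum>w\<in>S. ?l z (f w) * (1 when w = v)) = (if v \<in> S then ?l z (f v) else 0)"
      if "finite S" for S
    proof -
      have "(\<Sum>w\<in>S. ?l z (f w) * (1 when w = v)) = (\<Sum>w\<in>S. if w = v then ?l z (f w) else 0)"
        by (rule sum.cong) (auto simp: when_def)
      then show ?thesis using that by simp
    qed
    show ?thesis
      using fin disj
      by (auto simp: L_def lookup_add lookup_minus lookup_sum lookup_scaleR lookup_single *
          lookup_char_vector)
  qed

  define stab where "stab = (\<lambda>U. {v \<in> A. f v \<in> U} \<union> {v \<in> B. f v \<notin> U})"
  have char_stab: "L (char_vector U) + char_vector B = char_vector (stab U)"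
    if "U \<in> up_sets N R" for U
  proof (rule poly_mapping_eqI)
    fix v
    have "finite U" using that \<open>finite N\<close> finite_subset by (auto simp: up_sets_def)
    moreover have "finite (stab U)" using fin by (simp add: stab_def)
    ultimately show "?l (L (char_vector U) + char_vector B) v = ?l (char_vector (stab U)) v"
      using disj by (auto simp: lookup_L lookup_char_vector stab_def)
  qed
  have "stab ` up_sets N R = {S. stable_set (A \<union> B) E S}"
  proof (intro equalityI subsetI)
    fix S assume "S \<in> stab ` up_sets N R"
    then obtain U where U: "U \<in> up_sets N R" "S = stab U" by blast
    have "{u, v} \<notin> E" if uv: "u \<in> S" "v \<in> S" for u v
    proof
      assume "{u, v} \<in> E"
      then obtain a b where ab: "a \<in> A" "b \<in> B" "{u, v} = {a, b}" using E by blast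
      then obtain i where i: "i \<in> I" "a \<in> X i" "b \<in> Y i"
        using cover \<open>{u, v} \<in> E\<close> by metis
      have "a \<in> S" "b \<in> S" using ab(3) uv by (auto simp: doubleton_eq_iff)
      then have "f a \<in> U" "f b \<notin> U" using ab(1,2) disj by (auto simp: U(2) stab_def)
      \<comment> \<open>The biclique coordinate links \<open>f a\<close> to \<open>f b\<close>, so
        an up-set containing \<open>f a\<close> must contain \<open>f b\<close>.\<close>
      moreover have "(f a, n + h i) \<in> R" "(n + h i, f b) \<in> R"
        using i by (auto simp: R_def)
      moreover have "t \<in> U" if "(s, t) \<in> R" "s \<in> U" for s t
        using that U(1) by (auto simp: up_sets_def)
      ultimately show False by blast
    qed
    moreover have "S \<subseteq> A \<union> B" by (auto simp: U(2) stab_def)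
    ultimately show "S \<in> {S. stable_set (A \<union> B) E S}" by (auto simp: stable_set_def)
  next
    fix S assume "S \<in> {S. stable_set (A \<union> B) E S}"
    then have S: "S \<subseteq> A \<union> B" "\<And>u v. u \<in> S \<Longrightarrow> v \<in> S \<Longrightarrow> {u, v} \<notin> E"
      by (auto simp: stable_set_def)
    \<comment> \<open>Lifts \<open>S\<close> by giving each biclique variable its least admissible
      value, the maximum of \<open>x_a\<close> over \<open>X i\<close>.\<close>
    define U where "U = f ` (A \<inter> S \<union> (B - S)) \<union> {n + h i |i. i \<in> I \<and> X i \<inter> S \<noteq> {}}"
    have fU: "f v \<in> U \<longleftrightarrow> v \<in> A \<inter> S \<union> (B - S)" if "v \<in> A \<union> B" for v
      using inj_on_image_mem_iff[OF inj that, of "A \<inter> S \<union> (B - S)"] f[OF that]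
      by (auto simp: U_def)
    have hU: "n + h i \<in> U \<longleftrightarrow> X i \<inter> S \<noteq> {}" if "i \<in> I" for i
      using that injh f by (fastforce simp: U_def inj_on_def)
    have "U \<subseteq> N" using f h by (fastforce simp: U_def N_def)
    moreover have "t \<in> U" if st: "(s, t) \<in> R" "s \<in> U" for s t
    proof -
      obtain i where i: "i \<in> I"
        and "(\<exists>a\<in>X i. s = f a \<and> t = n + h i) \<or> (\<exists>b\<in>Y i. s = n + h i \<and> t = f b)"
        using st(1) by (auto simp: R_def)
      then consider a where "a \<in> X i" "s = f a" "t = n + h i"
        | b where "b \<in> Y i" "s = n + h i" "t = f b" by blast
      then show ?thesis
      proof cases
        case 1
        then have "a \<in> S" using fU[of a] st(2) XY(1)[OF i] disj by auto
        then show ?thesis using 1 hU[OF i] by auto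
      next
        case 2
        then obtain a where a: "a \<in> X i" "a \<in> S" using hU[OF i] st(2) by auto
        then have "{a, b} \<in> E" using cover[of a b] XY[OF i] i 2(1) by blast
        then have "b \<notin> S" using S(2) a(2) by blast
        then show ?thesis using 2 fU[of b] XY(2)[OF i] by auto
      qed
    qed
    ultimately have "U \<in> up_sets N R" by (auto simp: up_sets_def)
    moreover have "stab U = S" using fU S(1) disj by (auto simp: stab_def)
    ultimately show "S \<in> stab ` up_sets N R" by blast
  qed
  \<comment> \<open>Convex hulls commute with affine maps, so matching the indicator vectors is
    enough.\<close>
  then have "STAB (A \<union> B) E = convex hull (char_vector ` stab ` up_sets N R)"
    by (simp add: STAB_def)
  also have "char_vector ` stab ` up_sets N R =
      (\<lambda>x. char_vector B + x) ` L ` char_vector ` up_sets N R"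
    unfolding image_image by (rule image_cong) (simp_all add: char_stab[symmetric] add.commute)
  also have "convex hull \<dots> = (\<lambda>x. L x + char_vector B) ` order_polytope N R"
    unfolding convex_hull_translation order_polytope_eq_hull[OF \<open>finite N\<close>]
      convex_hull_linear_image[OF \<open>linear L\<close>, symmetric]
    by (simp add: image_image add.commute)
  finally have "affinely_projects_to (order_polytope N R) (STAB (A \<union> B) E)"
    using \<open>linear L\<close> unfolding affinely_projects_to_def by metis
  moreover have "polytope (order_polytope N R)"
    unfolding polytope_def order_polytope_eq_hull[OF \<open>finite N\<close>]
    using finite_up_sets[OF \<open>finite N\<close>] by blast
  ultimately have "extension_complexity (STAB (A \<union> B) E) \<le>
      card {F. is_facet_of F (order_polytope N R)}"
    unfolding extension_complexity_def by (intro Least_le) blast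
  also have "\<dots> \<le> card R + 2 * card N"
    using card_facets_order_polytope_le \<open>finite N\<close> \<open>finite R\<close> by blast
  also have "\<dots> \<le> 2 * (n + card I) + (\<Sum>i\<in>I. card (X i) + card (Y i))"
    using card_R by (simp add: N_def)
  finally show ?thesis by (simp add: n_def)
qed

section \<open>Cheap biclique covers and the choice of the block size\<close>

text \<open>Per block, the at most \<open>2 ^ k\<close> bicliques cost 2 each for their variables,
  their left sides have total size at most \<open>k * 2 ^ k\<close>, and their right sides are
  disjoint, hence of total size at most \<open>n\<close>.\<close>

lemma extension_complexity_STAB_le_blocks:
  fixes A B :: "'a set"
  assumes fin: "finite A" "finite B" and disj: "A \<inter> B = {}"
    and E: "\<And>e. e \<in> E \<Longrightarrow> \<exists>a\<in>A. \<exists>b\<in>B. e = {a, b}" and "0 < k"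
  defines "n \<equiv> card (A \<union> B)"
  shows "extension_complexity (STAB (A \<union> B) E) \<le> 2 * n + (n div k + 1) * (2 * 2 ^ k + k * 2 ^ k + n)"
proof -
  obtain f where "bij_betw f (A \<union> B) {0..<n}"
    unfolding n_def using fin ex_bij_betw_finite_nat[of "A \<union> B"] by auto
  then have inj: "inj_on f (A \<union> B)" and f: "\<And>v. v \<in> A \<union> B \<Longrightarrow> f v < n"
    by (auto simp: bij_betw_def)
  \<comment> \<open>Blocks of consecutive numbers. As \<open>f\<close> is below \<open>n\<close>,
    the indices 0 to \<open>n div k\<close> suffice; some blocks may be empty.\<close>
  define T where "T = (\<lambda>j. {a \<in> A. f a div k = j})"
  have finT: "finite (T j)" for j using fin by (simp add: T_def)
  have cardT: "card (T j) \<le> k" for j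
  proof -
    have "f ` T j \<subseteq> {j * k..<j * k + k}"
    proof
      fix x assume "x \<in> f ` T j"
      then have "x div k = j" by (auto simp: T_def)
      then show "x \<in> {j * k..<j * k + k}"
        using div_mult_mod_eq[of x k] mod_less_divisor[OF \<open>0 < k\<close>, of x]
        by (metis add_less_cancel_left atLeastLessThan_iff le_add1)
    qed
    then have "card (f ` T j) \<le> card {j * k..<j * k + k}"
      by (intro card_mono) auto
    moreover have "inj_on f (T j)" by (rule inj_on_subset[OF inj]) (auto simp: T_def)
    ultimately show ?thesis by (simp add: card_image)
  qed
  define nb where "nb = (\<lambda>j b. {a \<in> T j. {a, b} \<in> E})"
  define I where "I = (SIGMA j:{0..n div k}. Pow (T j))"
  \<comment> \<open>Requiring the trace on the block to equal the subset, not just to contain it,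
    makes the right sides of one block disjoint.\<close>
  define Y where "Y = (\<lambda>p. {b \<in> B. nb (fst p) b = snd p})"
  have finI: "finite I" using finT by (auto simp: I_def)
  have pow: "card (Pow (T j)) \<le> 2 ^ k" for j
    using cardT[of j] finT by (simp add: card_Pow power_increasing)
  have "extension_complexity (STAB (A \<union> B) E) \<le>
      2 * (card (A \<union> B) + card I) + (\<Sum>p\<in>I. card (snd p) + card (Y p))"
  proof (rule extension_complexity_STAB_le_biclique_cover[OF fin finI disj E])
    fix a b assume a: "a \<in> A" and b: "b \<in> B"
    have "f a div k \<le> n div k" using f[of a] a by (simp add: div_le_mono)
    then show "{a, b} \<in> E \<longleftrightarrow> (\<exists>p\<in>I. a \<in> snd p \<and> b \<in> Y p)"
      using a b
      by (auto simp: I_def Y_def nb_def T_def intro!: bexI[of _ "(f a div k, nb (f a div k) b)"])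
  qed (auto simp: I_def Y_def T_def)
  moreover have "card I \<le> (n div k + 1) * 2 ^ k"
  proof -
    have "card I = (\<Sum>j\<in>{0..n div k}. card (Pow (T j)))"
      unfolding I_def using finT by (intro card_SigmaI) auto
    also have "\<dots> \<le> (\<Sum>j\<in>{0..n div k}. 2 ^ k)" by (intro sum_mono pow)
    finally show ?thesis by simp
  qed
  moreover have "(\<Sum>p\<in>I. card (snd p) + card (Y p)) \<le> (n div k + 1) * (k * 2 ^ k + n)"
  proof -
    have "(\<Sum>p\<in>I. card (snd p) + card (Y p)) =
        (\<Sum>j\<in>{0..n div k}. (\<Sum>S\<in>Pow (T j). card S + card (Y (j, S))))"
      unfolding I_def using finT by (subst sum.Sigma) (auto simp: case_prod_unfold)
    also have "\<dots> \<le> (\<Sum>j\<in>{0..n div k}. k * 2 ^ k + n)"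
    proof (rule sum_mono)
      fix j
      have "(\<Sum>S\<in>Pow (T j). card S) \<le> card (Pow (T j)) * k"
        using sum_bounded_above[of "Pow (T j)" card k] cardT[of j] finT
        by (metis PowD card_mono le_trans of_nat_id)
      also have "\<dots> \<le> k * 2 ^ k" using mult_le_mono1[OF pow[of j], of k] by (simp add: mult.commute)
      finally have 1: "(\<Sum>S\<in>Pow (T j). card S) \<le> k * 2 ^ k" .
      have "(\<Sum>S\<in>Pow (T j). card (Y (j, S))) = card (\<Union>S\<in>Pow (T j). Y (j, S))"
        using finT fin by (intro card_UN_disjoint[symmetric]) (auto simp: Y_def)
      also have "\<dots> \<le> card (A \<union> B)"
        using fin by (intro card_mono) (auto simp: Y_def)
      finally show "(\<Sum>S\<in>Pow (T j). card S + card (Y (j, S))) \<le> k * 2 ^ k + n"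
        using 1 by (simp add: sum.distrib n_def)
    qed
    finally show ?thesis by simp
  qed
  ultimately show ?thesis unfolding n_def[symmetric] by (simp add: algebra_simps)
qed

text \<open>The greatest admissible \<open>k\<close> works: maximality bounds \<open>n\<close> by
  \<open>2 ^ (3 * k)\<close>. The hypothesis makes \<open>k = 1\<close> admissible.\<close>

lemma ex_block_size:
  fixes n :: nat
  assumes "2 \<le> n"
  obtains k where "0 < k" "k * 2 ^ k \<le> n" "ln (real n) \<le> 3 * real k"
proof -
  let ?P = "\<lambda>k. k * 2 ^ k \<le> n"
  have bound: "k \<le> n" if "?P k" for k
  proof -
    have "k * 1 \<le> k * 2 ^ k" by (intro mult_le_mono2) simp
    then show ?thesis using that by linarith
  qed
  define k where "k = (GREATEST k. ?P k)"
  have "?P 1" using assms by simp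
  have k: "?P k" unfolding k_def by (rule GreatestI_nat[of ?P, OF \<open>?P 1\<close>]) (use bound in blast)
  have "1 \<le> k" unfolding k_def by (rule Greatest_le_nat[of ?P, OF \<open>?P 1\<close>]) (use bound in blast)
  have "\<not> ?P (Suc k)"
    using Greatest_le_nat[of ?P "Suc k" n] bound unfolding k_def[symmetric] by fastforce
  then have "n < Suc k * 2 ^ Suc k" by simp
  \<comment> \<open>Uses \<open>Suc k \<le> 2 ^ k\<close>; the total exponent
    \<open>2 * k + 1\<close> is then at most \<open>3 * k\<close> because
    \<open>1 \<le> k\<close>.\<close>
  also have "\<dots> \<le> 2 ^ k * 2 ^ Suc k"
    by (intro mult_le_mono1 Suc_leI less_exp)
  also have "\<dots> \<le> 2 ^ (3 * k)"
    unfolding power_add[symmetric] using \<open>1 \<le> k\<close> by (intro power_increasing) auto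
  finally have "real n \<le> 2 ^ (3 * k)"
    by (metis less_imp_le numeral_power_eq_of_nat_cancel_iff of_nat_le_iff of_nat_numeral of_nat_power)
  then have "ln (real n) \<le> ln (2 ^ (3 * k))" using assms by simp
  also have "\<dots> = real (3 * k) * ln 2" by (rule ln_realpow)
  also have "\<dots> \<le> real (3 * k) * 1" using ln_2_less_1 by (intro mult_left_mono) auto
  finally show thesis using that[of k] k \<open>1 \<le> k\<close> by simp
qed

theorem theorem1:
  shows "\<exists>C::real. \<forall>(V::'a set) E. bipartite_graph V E \<and> card V \<ge> 2 \<longrightarrow>
    real (extension_complexity (STAB V E)) \<le> C * ((real (card V))\<^sup>2 / ln (real (card V)))"
proof (intro exI[of _ 30] allI impI)
  fix V :: "'a set" and E
  assume G: "bipartite_graph V E \<and> card V \<ge> 2"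
  define n where "n = card V"
  have "2 \<le> n" using G by (simp add: n_def)
  then obtain k where k: "0 < k" "k * 2 ^ k \<le> n" "ln (real n) \<le> 3 * real k"
    by (rule ex_block_size)
  have "\<exists>A B. A \<union> B = V \<and> A \<inter> B = {} \<and> (\<forall>e\<in>E. \<exists>a\<in>A. \<exists>b\<in>B. e = {a, b})"
    using G by (simp only: bipartite_graph_def)
  then obtain A B where AB: "A \<union> B = V" "A \<inter> B = {}"
    and E: "\<forall>e\<in>E. \<exists>a\<in>A. \<exists>b\<in>B. e = {a, b}"
    by (elim exE conjE)
  have "finite V" using G by (simp add: bipartite_graph_def simple_graph_def)
  then have "finite A" "finite B" using AB(1) by auto
  have "extension_complexity (STAB V E) \<le> 2 * n + (n div k + 1) * (2 * 2 ^ k + k * 2 ^ k + n)"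
    using extension_complexity_STAB_le_blocks[OF \<open>finite A\<close> \<open>finite B\<close> AB(2) bspec[OF E] k(1)]
    by (simp add: AB(1) n_def)
  also have "\<dots> \<le> 2 * n + (n div k + 1) * (4 * n)"
  proof -
    have "2 ^ k \<le> k * 2 ^ k" using k(1) by simp
    then show ?thesis using k(2) by (intro add_left_mono mult_le_mono2) linarith
  qed
  finally have "real (extension_complexity (STAB V E)) \<le>
      real (2 * n + (n div k + 1) * (4 * n))"
    by (simp only: of_nat_le_iff)
  also have "\<dots> = 2 * real n + (real (n div k) + 1) * (4 * real n)"
    by (simp add: algebra_simps)
  \<comment> \<open>Since \<open>1 \<le> n / k\<close>, both the linear term and the extra block are
    absorbed.\<close>
  also have "\<dots> \<le> 2 * (real n * (real n / k)) + (real n / k + real n / k) * (4 * real n)"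
  proof -
    have "k * 1 \<le> k * 2 ^ k" by (intro mult_le_mono2) simp
    then have "k \<le> n" using k(2) by linarith
    then have "1 \<le> real n / k" using k(1) by simp
    moreover have "real (n div k) \<le> real n / k" by (rule of_nat_div_le_of_nat)
    ultimately show ?thesis
      using mult_left_mono[of 1 "real n / k" "real n"]
      by (intro add_mono mult_right_mono) auto
  qed
  \<comment> \<open>The coefficients 2 and 8 add up to 10, and the factor 3 from
    \<open>ln n \<le> 3 * k\<close> makes it 30.\<close>
  also have "\<dots> = 30 * ((real n)\<^sup>2 / (3 * real k))"
    by (simp add: power2_eq_square field_simps)
  also have "\<dots> \<le> 30 * ((real n)\<^sup>2 / ln (real n))"
    using k \<open>2 \<le> n\<close> by (intro mult_left_mono divide_left_mono) auto
  finally show "real (extension_complexity (STAB V E)) \<le>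
      30 * ((real (card V))\<^sup>2 / ln (real (card V)))"
    by (simp add: n_def)
qed

end
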